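(* Let $\mathfrak{A}$ be a $C^*$-algebra, let $H$ and $K$ be Hilbert $\mathfrak{A}$-modules, and let $M$ and $N$ be orthogonally complemented closed submodules of $H$ and $K$, respectively. For every $T\in\mathcal{L}(H,K)$, the following statements are equivalent: (i) $T$ is $(M,N)$-complementable. (ii) Each of the systems $$T_{22}X=T_{21},\quad X\in\mathcal{L}(M,M^\perp),$$ $$T_{22}^*Y=T_{12}^*,\quad Y\in\mathcal{L}(N,N^\perp),$$ has a solution. (iii) There exist idempotents $P\in\mathcal{L}(H)$ and $Q\in\mathcal{L}(K)$ such that $$\mathcal{R}(P^* )=M,\quad \mathcal{R}(TP)\subseteq N,\quad \mathcal{R}(Q)=N,\quad \mathcal{R}\big((QT)^*\big)\subseteq M.$$ (iv) $H$ and $K$ can be decomposed algebraically as $$H=M^\perp+\mathcal{N}\big[(I_K-P_N)T(I_M-C)P_M\big],$$ $$K=N^\perp+\mathcal{N}\big[(I_H-P_M)T^*(I_N-D)P_N\big]$$ for some $C\in\mathcal{L}(M,M^\perp)$ and $D\in\mathcal{L}(N,N^\perp)$.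
   Context: For Hilbert $\mathfrak{A}$-modules $H,K$, $\mathcal{L}(H,K)$ denotes the set of adjointable operators from $H$ to $K$, and $\mathcal{L}(H)=\mathcal{L}(H,H)$. $\mathcal{R}(\cdot)$ and $\mathcal{N}(\cdot)$ denote range and null space, and $I_H$ the identity on $H$. A closed submodule $M\subseteq H$ is orthogonally complemented if $H=M+M^\perp$; $P_M$ is then the projection of $H$ onto $M$. An idempotent is an operator $P$ with $P^2=P$. The sign $+$ between submodules is the algebraic (not necessarily direct) sum. For $C\in\mathcal{L}(M,M^\perp)$, $I_M-C$ is the operator $M\to H$, $x\mapsto x-Cx$; similarly $I_N-D:N\to K$. Blocks of $T\in\mathcal{L}(H,K)$: with $P_{M^\perp}=I_H-P_M$, $P_{N^\perp}=I_K-P_N$, $T_{11}=P_NTP_M|_M\in\mathcal{L}(M,N)$, $T_{12}=P_NTP_{M^\perp}|_{M^\perp}\in\mathcal{L}(M^\perp,N)$, $T_{21}=P_{N^\perp}TP_M|_M\in\mathcal{L}(M,N^\perp)$, $T_{22}=P_{N^\perp}TP_{M^\perp}|_{M^\perp}\in\mathcal{L}(M^\perp,N^\perp)$. $T\in\mathcal{L}(H,K)$ is $(M,N)$-complementable if there exist $M_r\in\mathcal{L}(H)$ and $M_l\in\mathcal{L}(K)$ such that $(I_H-P_M)M_r=M_r$, $M_l(I_K-P_N)=M_l$, $(I_K-P_N)TM_r=(I_K-P_N)T$ and $M_lT(I_H-P_M)=T(I_H-P_M)$. *)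

theory Defs
  imports "HOL-Analysis.Analysis" "HOL-Library.FuncSet" "HOL-Library.Set_Algebras"
begin

class scaleC =
  fixes scaleC :: "complex \<Rightarrow> 'a \<Rightarrow> 'a"  (infixr "*\<^sub>C" 75)

class complex_banach = banach + scaleC +
  assumes scaleC_add_right: "c *\<^sub>C (x + y) = c *\<^sub>C x + c *\<^sub>C y"
    and scaleC_add_left: "(c + d) *\<^sub>C x = c *\<^sub>C x + d *\<^sub>C x"
    and scaleC_scaleC: "c *\<^sub>C d *\<^sub>C x = (c * d) *\<^sub>C x"
    and scaleR_scaleC: "r *\<^sub>R x = complex_of_real r *\<^sub>C x"
    and norm_scaleC: "norm (c *\<^sub>C x) = cmod c * norm x"

text \<open>C*-algebras are not required to be unital.\<close>

class cstar_algebra = real_normed_algebra + complex_banach +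
  fixes star :: "'a \<Rightarrow> 'a"
  assumes mult_scaleC_left: "(c *\<^sub>C a) * b = c *\<^sub>C (a * b)"
    and mult_scaleC_right: "a * (c *\<^sub>C b) = c *\<^sub>C (a * b)"
    and star_star: "star (star a) = a"
    and star_add: "star (a + b) = star a + star b"
    and star_mult: "star (a * b) = star b * star a"
    and star_scaleC: "star (c *\<^sub>C a) = cnj c *\<^sub>C star a"
    and cstar_identity: "norm (star a * a) = (norm a)\<^sup>2"

definition cstar_nonneg :: "'a::cstar_algebra \<Rightarrow> bool" where
  "cstar_nonneg a \<longleftrightarrow> (\<exists>b. a = star b * b)"

text \<open>
  Hilbert modules are right modules with an inner product that is linear in the second
  variable. Completeness comes from the class of the carrier type, whose norm is tied to the
  inner product by \<open>norm_eq\<close>.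
\<close>

locale hilbert_module =
  fixes act :: "'h::complex_banach \<Rightarrow> 'a::cstar_algebra \<Rightarrow> 'h"
    and ip :: "'h \<Rightarrow> 'h \<Rightarrow> 'a"
  assumes act_add_left: "act (x + y) a = act x a + act y a"
    and act_add_right: "act x (a + b) = act x a + act x b"
    and act_mult: "act x (a * b) = act (act x a) b"
    and act_scaleC_left: "act (c *\<^sub>C x) a = c *\<^sub>C act x a"
    and act_scaleC_right: "act x (c *\<^sub>C a) = c *\<^sub>C act x a"
    and ip_add_right: "ip x (y + z) = ip x y + ip x z"
    and ip_scaleC_right: "ip x (c *\<^sub>C y) = c *\<^sub>C ip x y"
    and ip_act_right: "ip x (act y a) = ip x y * a"
    and ip_star: "ip y x = star (ip x y)"
    and ip_nonneg: "cstar_nonneg (ip x x)"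
    and ip_definite: "ip x x = 0 \<Longrightarrow> x = 0"
    and norm_eq: "norm x = sqrt (norm (ip x x))"

definition submodule :: "('h::complex_banach \<Rightarrow> 'a::cstar_algebra \<Rightarrow> 'h) \<Rightarrow> 'h set \<Rightarrow> bool" where
  "submodule act M \<longleftrightarrow> 0 \<in> M \<and> (\<forall>x\<in>M. \<forall>y\<in>M. x + y \<in> M)
     \<and> (\<forall>x\<in>M. \<forall>c. c *\<^sub>C x \<in> M) \<and> (\<forall>x\<in>M. \<forall>a. act x a \<in> M)"

definition orth :: "('h \<Rightarrow> 'h \<Rightarrow> 'a::zero) \<Rightarrow> 'h set \<Rightarrow> 'h set" where
  "orth ip M = {x. \<forall>y\<in>M. ip x y = 0}"

text \<open>Here \<open>+\<close> on sets is elementwise addition (\<open>HOL-Library.Set_Algebras\<close>).\<close>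

definition orth_complemented ::
    "('h::complex_banach \<Rightarrow> 'a::cstar_algebra \<Rightarrow> 'h) \<Rightarrow> ('h \<Rightarrow> 'h \<Rightarrow> 'a) \<Rightarrow> 'h set \<Rightarrow> bool" where
  "orth_complemented act ip M \<longleftrightarrow> submodule act M \<and> closed M \<and> UNIV = M + orth ip M"

definition proj :: "('h::complex_banach \<Rightarrow> 'h \<Rightarrow> 'a::zero) \<Rightarrow> 'h set \<Rightarrow> 'h \<Rightarrow> 'h" where
  "proj ip M x = (THE m. m \<in> M \<and> x - m \<in> orth ip M)"

text \<open>
  Operators between submodules \<open>M\<close> and \<open>N\<close> are extensional functions, so that equality of
  operators is equality of HOL functions; for \<open>M = UNIV\<close> extensionality is no constraint.
  As usual, adjointable means only that an adjoint exists: module linearity and boundedness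
  are consequences.
\<close>

definition adjointables ::
    "('h \<Rightarrow> 'h \<Rightarrow> 'a) \<Rightarrow> ('k \<Rightarrow> 'k \<Rightarrow> 'a) \<Rightarrow> 'h set \<Rightarrow> 'k set \<Rightarrow> ('h \<Rightarrow> 'k) set" where
  "adjointables ipH ipK M N =
     {T \<in> M \<rightarrow>\<^sub>E N. \<exists>S \<in> N \<rightarrow> M. \<forall>x\<in>M. \<forall>y\<in>N. ipK (T x) y = ipH x (S y)}"

definition adj ::
    "('h \<Rightarrow> 'h \<Rightarrow> 'a) \<Rightarrow> ('k \<Rightarrow> 'k \<Rightarrow> 'a) \<Rightarrow> 'h set \<Rightarrow> 'k set \<Rightarrow> ('h \<Rightarrow> 'k) \<Rightarrow> 'k \<Rightarrow> 'h" where
  "adj ipH ipK M N T = (\<lambda>y\<in>N. THE x. x \<in> M \<and> (\<forall>z\<in>M. ipK (T z) y = ipH z x))"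

text \<open>
  The block of \<open>T\<close> from \<open>A\<close> to \<open>B\<close>: with \<open>A\<close> one of \<open>M\<close>, \<open>orth ipH M\<close> and \<open>B\<close> one of \<open>N\<close>,
  \<open>orth ipK N\<close> this gives the four blocks.
\<close>

definition block ::
    "('h::complex_banach \<Rightarrow> 'h \<Rightarrow> 'a::zero) \<Rightarrow> ('k::complex_banach \<Rightarrow> 'k \<Rightarrow> 'a)
      \<Rightarrow> ('h \<Rightarrow> 'k) \<Rightarrow> 'h set \<Rightarrow> 'k set \<Rightarrow> 'h \<Rightarrow> 'k" where
  "block ipH ipK T A B = restrict (proj ipK B \<circ> T \<circ> proj ipH A) A"

abbreviation null_space :: "('h \<Rightarrow> 'k::zero) \<Rightarrow> 'h set" where
  "null_space f \<equiv> f -` {0}"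

text \<open>The difference of functions is pointwise, so \<open>id - proj ip M\<close> is the complementary projection.\<close>

definition complementable ::
    "('h::complex_banach \<Rightarrow> 'h \<Rightarrow> 'a::zero) \<Rightarrow> ('k::complex_banach \<Rightarrow> 'k \<Rightarrow> 'a)
      \<Rightarrow> 'h set \<Rightarrow> 'k set \<Rightarrow> ('h \<Rightarrow> 'k) \<Rightarrow> bool" where
  "complementable ipH ipK M N T \<longleftrightarrow>
     (\<exists>Mr \<in> adjointables ipH ipH UNIV UNIV. \<exists>Ml \<in> adjointables ipK ipK UNIV UNIV.
        (id - proj ipH M) \<circ> Mr = Mr \<and>
        Ml \<circ> (id - proj ipK N) = Ml \<and>
        (id - proj ipK N) \<circ> T \<circ> Mr = (id - proj ipK N) \<circ> T \<and>
        Ml \<circ> T \<circ> (id - proj ipH M) = T \<circ> (id - proj ipH M))"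

end

theory Submission
  imports Defs
begin

text \<open>
  Taking adjoints exchanges the two halves of each statement: the conditions on \<open>M\<^sub>l\<close>, \<open>Y\<close>,
  \<open>Q\<close>, \<open>D\<close> are those on \<open>M\<^sub>r\<close>, \<open>X\<close>, \<open>P\<close>, \<open>C\<close> for \<open>T\<^sup>*\<close> and \<open>(N, M)\<close>. Each condition of the first
  half says that some adjointable \<open>X : M \<rightarrow> M\<^sup>\<bottom>\<close> satisfies \<open>T (X x) - T x \<in> N\<close> for all \<open>x \<in> M\<close>, with
  \<open>M\<^sub>r = X P\<^sub>M + (I - P\<^sub>M)\<close>, \<open>P = (I - X) P\<^sub>M\<close> and \<open>C = X\<close>.
\<close>

section \<open>Adjoint pairs and splitting subgroups\<close>

text \<open>Carrying the adjoint as a second argument keeps the description operator of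
  \<open>adj\<close> out of the calculations; \<open>adj_UNIV\<close> translates back.\<close>

definition is_adjoint ::
    "('h \<Rightarrow> 'h \<Rightarrow> 'a) \<Rightarrow> ('k \<Rightarrow> 'k \<Rightarrow> 'a) \<Rightarrow> ('h \<Rightarrow> 'k) \<Rightarrow> ('k \<Rightarrow> 'h) \<Rightarrow> bool" where
  "is_adjoint ipH ipK T S \<longleftrightarrow> (\<forall>x y. ipK (T x) y = ipH x (S y))"

lemma adjointables_UNIV_iff:
  "T \<in> adjointables ipH ipK UNIV UNIV \<longleftrightarrow> (\<exists>S. is_adjoint ipH ipK T S)"
  by (auto simp: adjointables_def is_adjoint_def)

lemma is_adjoint_comp:
  assumes "is_adjoint ipH ipK T S" "is_adjoint ipK ipL U V"
  shows "is_adjoint ipH ipL (U \<circ> T) (S \<circ> V)"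
  using assms by (simp add: is_adjoint_def)

lemma is_adjoint_id: "is_adjoint ip ip id id"
  by (simp add: is_adjoint_def)

text \<open>The additive core of \<open>orth_complemented\<close>: closure under differences gives
  uniqueness of the decomposition, the sum gives existence. It passes to \<open>orth ip M\<close>,
  so a submodule and its complement fall under the same lemmas.\<close>

definition splits :: "('h::ab_group_add \<Rightarrow> 'h \<Rightarrow> 'a::zero) \<Rightarrow> 'h set \<Rightarrow> bool" where
  "splits ip M \<longleftrightarrow> (\<forall>x\<in>M. \<forall>y\<in>M. x - y \<in> M) \<and> UNIV = M + orth ip M"

lemma scaleC_minus_one: "(-1) *\<^sub>C x = - (x :: 'a :: complex_banach)"
proof -
  have "(-1) *\<^sub>C x = complex_of_real (-1) *\<^sub>C x" by simp
  also have "\<dots> = - x" by (simp only: scaleR_scaleC[symmetric] scaleR_minus1_left)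
  finally show ?thesis .
qed

lemma orth_complemented_splits: "orth_complemented act ip M \<Longrightarrow> splits ip M"
proof -
  assume M: "orth_complemented act ip M"
  have "x - y \<in> M" if "x \<in> M" "y \<in> M" for x y
  proof -
    have "x + (-1) *\<^sub>C y \<in> M"
      using M that unfolding orth_complemented_def submodule_def by blast
    then show ?thesis by (simp add: scaleC_minus_one)
  qed
  with M show ?thesis by (simp add: splits_def orth_complemented_def)
qed

section \<open>Inner product and orthogonal projections in one Hilbert module\<close>

context hilbert_module
begin

lemma ip_add_left: "ip (x + y) z = ip x z + ip y z"
  by (metis ip_add_right ip_star star_add)

lemma ip_diff_right: "ip x (y - z) = ip x y - ip x z"
  by (metis add_diff_cancel_right' diff_add_cancel ip_add_right)

lemma ip_diff_left: "ip (x - y) z = ip x z - ip y z"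
  by (metis add_diff_cancel_right' diff_add_cancel ip_add_left)

lemma ip_zero_left [simp]: "ip 0 x = 0"
  using ip_diff_left[of 0 0 x] by simp

lemma ip_commute_eq_zero: "ip x y = 0 \<longleftrightarrow> ip y x = 0"
  by (metis ip_star ip_zero_left)

lemma ip_ext_right: "(\<And>z. ip z x = ip z y) \<Longrightarrow> x = y"
  using ip_definite[of "x - y"] by (simp add: ip_diff_right)

lemma ip_ext_left: "(\<And>z. ip x z = ip y z) \<Longrightarrow> x = y"
  using ip_definite[of "x - y"] by (simp add: ip_diff_left)

lemma orth_diff: "x \<in> orth ip M \<Longrightarrow> y \<in> orth ip M \<Longrightarrow> x - y \<in> orth ip M"
  by (simp add: orth_def ip_diff_left)

lemma orth_eq_zero: "x \<in> M \<Longrightarrow> x \<in> orth ip M \<Longrightarrow> x = 0"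
  by (simp add: orth_def ip_definite)

text \<open>The decomposition of the whole space is the same one read backwards, since
  \<open>M\<close> lies in its double complement.\<close>

lemma splits_orth:
  assumes "splits ip M"
  shows "splits ip (orth ip M)"
proof -
  have "M \<subseteq> orth ip (orth ip M)"
    using ip_commute_eq_zero by (auto simp: orth_def)
  moreover have "UNIV = orth ip M + M"
    using assms by (metis splits_def add.commute)
  ultimately show ?thesis
    using set_plus_mono2[OF order_refl, of M "orth ip (orth ip M)" "orth ip M"]
    by (auto simp: splits_def orth_diff)
qed

text \<open>Two candidates differ by an element of both \<open>M\<close> and
  \<open>orth ip M\<close>, which is zero by definiteness.\<close>

lemma proj_eqI:
  assumes "splits ip M" "m \<in> M" "x - m \<in> orth ip M"
  shows "proj ip M x = m"
  unfolding proj_def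
proof (rule the_equality)
  fix n assume n: "n \<in> M \<and> x - n \<in> orth ip M"
  then have "n - m \<in> M" using assms by (simp add: splits_def)
  moreover have "n - m \<in> orth ip M"
    using orth_diff[of "x - m" M "x - n"] n assms by simp
  ultimately show "n = m" using orth_eq_zero by fastforce
qed (use assms in simp)

lemma proj_mem_orth:
  assumes "splits ip M"
  shows "proj ip M x \<in> M \<and> x - proj ip M x \<in> orth ip M"
proof -
  have "x \<in> M + orth ip M" using assms by (metis UNIV_I splits_def)
  then obtain m n where mn: "m \<in> M" "n \<in> orth ip M" "x = m + n"
    by (auto elim: set_plus_elim)
  then have "proj ip M x = m" using assms by (intro proj_eqI) auto
  with mn show ?thesis by simp
qed

lemmas proj_mem = proj_mem_orth[THEN conjunct1]
  and diff_proj_orth = proj_mem_orth[THEN conjunct2]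

lemma zero_mem_splits:
  assumes "splits ip M"
  shows "0 \<in> M"
  using assms proj_mem[OF assms, of 0] by (metis diff_self splits_def)

lemma proj_same: "splits ip M \<Longrightarrow> x \<in> M \<Longrightarrow> proj ip M x = x"
  by (rule proj_eqI) (auto simp: orth_def)

lemma proj_fixed_iff: "splits ip M \<Longrightarrow> proj ip M x = x \<longleftrightarrow> x \<in> M"
  using proj_same proj_mem by metis

lemma proj_orth: "splits ip M \<Longrightarrow> x \<in> orth ip M \<Longrightarrow> proj ip M x = 0"
  by (rule proj_eqI) (auto simp: zero_mem_splits)

lemma proj_eq_zero_iff: "splits ip M \<Longrightarrow> proj ip M x = 0 \<longleftrightarrow> x \<in> orth ip M"
  using proj_orth diff_proj_orth by (metis diff_zero)

lemma proj_diff: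
  assumes "splits ip M"
  shows "proj ip M (x - y) = proj ip M x - proj ip M y"
proof (rule proj_eqI[OF assms])
  show "proj ip M x - proj ip M y \<in> M"
    using assms proj_mem[OF assms] by (simp add: splits_def)
  have "x - y - (proj ip M x - proj ip M y) = (x - proj ip M x) - (y - proj ip M y)" by simp
  then show "x - y - (proj ip M x - proj ip M y) \<in> orth ip M"
    using orth_diff diff_proj_orth[OF assms] by metis
qed

lemma proj_orth_eq:
  assumes "splits ip M"
  shows "proj ip (orth ip M) x = x - proj ip M x"
proof (rule proj_eqI[OF splits_orth[OF assms]])
  show "x - (x - proj ip M x) \<in> orth ip (orth ip M)"
    using proj_mem[OF assms, of x] ip_commute_eq_zero by (auto simp: orth_def)
qed (rule diff_proj_orth[OF assms])

lemma ip_proj_left: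
  assumes "splits ip M" "y \<in> M"
  shows "ip (proj ip M x) y = ip x y"
  using diff_proj_orth[OF assms(1), of x] assms(2) by (simp add: orth_def ip_diff_left)

lemma ip_proj_right:
  assumes "splits ip M" "x \<in> M"
  shows "ip x (proj ip M y) = ip x y"
  using ip_proj_left[OF assms, of y] by (metis ip_star)

lemma is_adjoint_proj: "splits ip M \<Longrightarrow> is_adjoint ip ip (proj ip M) (proj ip M)"
  using ip_proj_left[OF _ proj_mem] ip_proj_right[OF _ proj_mem]
  by (simp add: is_adjoint_def)

lemma is_adjoint_diff:
  "is_adjoint ip ip A B \<Longrightarrow> is_adjoint ip ip A' B' \<Longrightarrow> is_adjoint ip ip (A - A') (B - B')"
  by (simp add: is_adjoint_def ip_diff_left ip_diff_right)

text \<open>Projecting the values of \<open>G\<close> to \<open>A\<close> gives an adjoint of the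
  restriction, because inner products with elements of \<open>A\<close> do not see the component in
  \<open>orth ip A\<close>.\<close>

lemma restrict_adjointable:
  assumes F: "is_adjoint ip ip F G" and A: "splits ip A" and "F \<in> A \<rightarrow> B"
  shows "restrict F A \<in> adjointables ip ip A B"
  unfolding adjointables_def
proof (intro CollectI conjI bexI ballI)
  show "(proj ip A \<circ> G) \<in> B \<rightarrow> A" using proj_mem[OF A] by simp
  fix x y assume "x \<in> A" "y \<in> B"
  then show "ip (restrict F A x) y = ip x ((proj ip A \<circ> G) y)"
    using F by (simp add: is_adjoint_def ip_proj_right[OF A])
qed (use assms in auto)

text \<open>Precomposing with the projection extends \<open>X\<close> by zero on
  \<open>orth ip A\<close>, and likewise for its adjoint. This turns a solution between submodules
  into an operator on the whole module.\<close>

lemma adjointable_extension: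
  assumes A: "splits ip A" and B: "splits ip B" and X: "X \<in> adjointables ip ip A B"
  obtains X' where "is_adjoint ip ip (X \<circ> proj ip A) (X' \<circ> proj ip B)" "X' \<in> B \<rightarrow> A"
proof -
  from X obtain X' where X': "X' \<in> B \<rightarrow> A" "\<And>x y. x \<in> A \<Longrightarrow> y \<in> B \<Longrightarrow> ip (X x) y = ip x (X' y)"
    and XAB: "X \<in> A \<rightarrow> B"
    by (auto simp: adjointables_def PiE_def)
  have "ip (X (proj ip A x)) y = ip x (X' (proj ip B y))" for x y
  proof -
    have "X (proj ip A x) \<in> B" "X' (proj ip B y) \<in> A"
      using X'(1) XAB proj_mem A B by blast+
    then have "ip (X (proj ip A x)) y = ip (X (proj ip A x)) (proj ip B y)"
      by (simp add: ip_proj_right[OF B])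
    also have "\<dots> = ip (proj ip A x) (X' (proj ip B y))"
      by (simp add: X' proj_mem A B)
    also have "\<dots> = ip x (X' (proj ip B y))"
      by (simp add: ip_proj_left[OF A] \<open>X' (proj ip B y) \<in> A\<close>)
    finally show ?thesis .
  qed
  then have "is_adjoint ip ip (X \<circ> proj ip A) (X' \<circ> proj ip B)"
    by (simp add: is_adjoint_def)
  then show thesis using X'(1) that by blast
qed

end

section \<open>Passing to adjoints between two modules\<close>

locale two_modules = H: hilbert_module actH ipH + K: hilbert_module actK ipK
  for actH :: "'h::complex_banach \<Rightarrow> 'a::cstar_algebra \<Rightarrow> 'h" and ipH
    and actK :: "'k::complex_banach \<Rightarrow> 'a \<Rightarrow> 'k" and ipK
begin

lemma is_adjoint_sym: "is_adjoint ipH ipK T S \<Longrightarrow> is_adjoint ipK ipH S T"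
  by (metis is_adjoint_def H.ip_star K.ip_star)

text \<open>Taking adjoints is a bijection between the two sets of operators, so an existence claim
  can be transferred to the adjoint.\<close>

lemma bex_adjointables_swap:
  assumes "\<And>U V. is_adjoint ipH ipK U V \<Longrightarrow> f U \<longleftrightarrow> g V"
  shows "(\<exists>U \<in> adjointables ipH ipK UNIV UNIV. f U) \<longleftrightarrow>
    (\<exists>V \<in> adjointables ipK ipH UNIV UNIV. g V)"
proof -
  interpret swap: two_modules actK ipK actH ipH ..
  show ?thesis
    unfolding Bex_def adjointables_UNIV_iff using assms is_adjoint_sym swap.is_adjoint_sym by blast
qed

lemma adjoint_eq_iff:
  assumes "is_adjoint ipH ipK T S" "is_adjoint ipH ipK T' S'"
  shows "T = T' \<longleftrightarrow> S = S'"
proof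
  assume "T = T'"
  then show "S = S'" using assms by (intro ext H.ip_ext_right) (metis is_adjoint_def)
next
  assume "S = S'"
  then show "T = T'" using assms by (intro ext K.ip_ext_left) (metis is_adjoint_def)
qed

lemma is_adjoint_additive:
  assumes "is_adjoint ipH ipK T S"
  shows "T (x - y) = T x - T y"
  by (rule K.ip_ext_left) (use assms in \<open>simp add: is_adjoint_def K.ip_diff_left H.ip_diff_left\<close>)

lemma adj_UNIV:
  assumes "is_adjoint ipH ipK T S"
  shows "adj ipH ipK UNIV UNIV T = S"
proof
  fix y
  show "adj ipH ipK UNIV UNIV T y = S y"
    unfolding adj_def restrict_UNIV
  proof (rule the_equality)
    fix x assume "x \<in> UNIV \<and> (\<forall>z\<in>UNIV. ipK (T z) y = ipH z x)"
    then show "x = S y"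
      using assms by (intro H.ip_ext_right) (simp add: is_adjoint_def)
  qed (use assms in \<open>simp add: is_adjoint_def\<close>)
qed

text \<open>Projections are self-adjoint, so the adjoint of a block is the block of \<open>S\<close>
  with the two submodules exchanged. Hence the system for \<open>Y\<close> is the system for
  \<open>X\<close> with \<open>S\<close> in place of \<open>T\<close>.\<close>

lemma adj_block:
  assumes TS: "is_adjoint ipH ipK T S" and A: "splits ipH A" and B: "splits ipK B"
  shows "adj ipH ipK A B (block ipH ipK T A B) = block ipK ipH S B A"
proof
  fix y
  show "adj ipH ipK A B (block ipH ipK T A B) y = block ipK ipH S B A y"
  proof (cases "y \<in> B")
    case True
    have eq: "ipK (block ipH ipK T A B z) y = ipH z (proj ipH A (S y))" if "z \<in> A" for z
      using that True TS
      by (simp add: block_def H.proj_same[OF A] K.ip_proj_left[OF B] H.ip_proj_right[OF A]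
          is_adjoint_def)
    have "(THE x. x \<in> A \<and> (\<forall>z\<in>A. ipK (block ipH ipK T A B z) y = ipH z x)) = proj ipH A (S y)"
    proof (rule the_equality)
      fix x assume x: "x \<in> A \<and> (\<forall>z\<in>A. ipK (block ipH ipK T A B z) y = ipH z x)"
      \<comment> \<open>Only elements of \<open>A\<close> are available as test vectors; the
        difference lies in \<open>A\<close> and can therefore be tested against itself.\<close>
      then have "x - proj ipH A (S y) \<in> A"
        using A H.proj_mem[OF A] by (simp add: splits_def)
      then show "x = proj ipH A (S y)"
        using x eq H.ip_definite[of "x - proj ipH A (S y)"]
        by (simp add: H.ip_diff_right)
    qed (use eq H.proj_mem[OF A] in auto)
    then show ?thesis
      using True by (simp add: adj_def block_def K.proj_same[OF B])
  qed (simp add: adj_def block_def)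
qed

end

section \<open>One half of each statement, for a fixed adjoint pair\<close>

locale split_operator = two_modules +
  fixes M N T S
  assumes splits_M: "splits ipH M" and splits_N: "splits ipK N"
    and adjoint_T: "is_adjoint ipH ipK T S"
begin

abbreviation "M' \<equiv> orth ipH M"
abbreviation "N' \<equiv> orth ipK N"
abbreviation "PM \<equiv> proj ipH M"
abbreviation "PN \<equiv> proj ipK N"

interpretation HH: two_modules actH ipH actH ipH ..

lemmas splits_M' = H.splits_orth[OF splits_M]
  and adjoint_PM = H.is_adjoint_proj[OF splits_M]
  and T_diff = is_adjoint_additive[OF adjoint_T]

text \<open>Geometrically, \<open>T\<close> maps the set of all \<open>x - X x\<close> with
  \<open>x\<close> in \<open>M\<close>, an algebraic complement of \<open>M'\<close>, into
  \<open>N\<close>.\<close>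

definition reducible :: bool where
  "reducible \<longleftrightarrow> (\<exists>X \<in> adjointables ipH ipH M M'. \<forall>x\<in>M. T (X x) - T x \<in> N)"

text \<open>Membership in \<open>N\<close> means being fixed by \<open>PN\<close>; in this form it
  matches equations between maps preceded by \<open>id - PN\<close>.\<close>

lemma diff_mem_N_iff: "a - b \<in> N \<longleftrightarrow> a - PN a = b - PN b"
  unfolding K.proj_fixed_iff[OF splits_N, symmetric] K.proj_diff[OF splits_N]
  by (auto simp: algebra_simps)

lemma adjointable_mem: "X \<in> adjointables ipH ipH M M' \<Longrightarrow> x \<in> M \<Longrightarrow> X x \<in> M'"
  by (auto simp: adjointables_def)

lemma reducible_iff_equation:
  "reducible \<longleftrightarrow> (\<exists>X \<in> adjointables ipH ipH M M'.
     compose M (block ipH ipK T M' N') X = block ipH ipK T M N')"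
proof -
  have "compose M (block ipH ipK T M' N') X = block ipH ipK T M N' \<longleftrightarrow>
      (\<forall>x\<in>M. T (X x) - T x \<in> N)" if "X \<in> adjointables ipH ipH M M'" for X
    using adjointable_mem[OF that]
    by (auto simp: fun_eq_iff compose_def block_def diff_mem_N_iff restrict_def
        H.proj_same[OF splits_M] H.proj_same[OF splits_M'] K.proj_orth_eq[OF splits_N])
  then show ?thesis by (auto simp: reducible_def)
qed

text \<open>The converse restricts \<open>R\<close> to \<open>M\<close>: \<open>PM\<close>
  annihilates the values of \<open>R\<close>, so they lie in \<open>M'\<close>.\<close>

lemma reducible_iff_right_factor:
  "reducible \<longleftrightarrow> (\<exists>R \<in> adjointables ipH ipH UNIV UNIV.
     (id - PM) \<circ> R = R \<and> (id - PN) \<circ> T \<circ> R = (id - PN) \<circ> T)" (is "_ \<longleftrightarrow> ?rhs")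
proof
  assume reducible
  then obtain X where X: "X \<in> adjointables ipH ipH M M'"
    and XN: "\<And>x. x \<in> M \<Longrightarrow> T (X x) - T x \<in> N"
    by (auto simp: reducible_def)
  obtain X' where "is_adjoint ipH ipH (X \<circ> PM) (X' \<circ> proj ipH M')"
    using H.adjointable_extension[OF splits_M splits_M' X] .
  \<comment> \<open>This is \<open>X\<close> after \<open>PM\<close> plus the complementary
    projection, written with differences only so that \<open>is_adjoint_diff\<close> applies
    twice.\<close>
  then have "is_adjoint ipH ipH ((X \<circ> PM) - (PM - id)) ((X' \<circ> proj ipH M') - (PM - id))"
    by (rule H.is_adjoint_diff[OF _ H.is_adjoint_diff[OF adjoint_PM is_adjoint_id]])
  then have adj: "(X \<circ> PM) - (PM - id) \<in> adjointables ipH ipH UNIV UNIV"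
    by (auto simp: adjointables_UNIV_iff)
  have "X (PM x) - (PM x - x) \<in> M'" for x
  proof -
    have "0 - (x - PM x) \<in> M'"
      by (intro H.orth_diff H.zero_mem_splits splits_M' H.diff_proj_orth splits_M)
    then show ?thesis
      using H.orth_diff[OF adjointable_mem[OF X H.proj_mem[OF splits_M]], of "PM x - x"] by simp
  qed
  then have "PM (X (PM x) - (PM x - x)) = 0" for x
    by (simp add: H.proj_eq_zero_iff[OF splits_M] algebra_simps)
  moreover have "T (X (PM x) - (PM x - x)) - T x \<in> N" for x
  proof -
    have "T (X (PM x) - (PM x - x)) - T x = T (X (PM x)) - T (PM x)"
      unfolding T_diff[symmetric] by simp
    then show ?thesis using XN H.proj_mem[OF splits_M] by simp
  qed
  ultimately show ?rhs
    by (intro bexI[OF _ adj]) (simp add: fun_eq_iff diff_mem_N_iff)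
next
  assume ?rhs
  then obtain R R' where R: "is_adjoint ipH ipH R R'"
    and "(id - PM) \<circ> R = R" and TR: "(id - PN) \<circ> T \<circ> R = (id - PN) \<circ> T"
    by (auto simp: adjointables_UNIV_iff)
  then have "PM (R x) = 0" for x by (simp add: fun_eq_iff)
  then have "restrict R M \<in> adjointables ipH ipH M M'"
    by (intro H.restrict_adjointable[OF R splits_M]) (simp add: H.proj_eq_zero_iff[OF splits_M])
  moreover have "\<forall>x\<in>M. T (restrict R M x) - T x \<in> N"
    using TR by (simp add: fun_eq_iff diff_mem_N_iff)
  ultimately show reducible unfolding reducible_def by blast
qed

text \<open>For the converse, the adjoint of \<open>P\<close> is an idempotent with range
  \<open>M\<close>, so it fixes \<open>M\<close> pointwise; taking adjoints gives
  \<open>PM \<circ> P = PM\<close>, and \<open>X\<close> is the identity minus \<open>P\<close> on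
  \<open>M\<close>.\<close>

lemma reducible_iff_idempotent:
  "reducible \<longleftrightarrow> (\<exists>P \<in> adjointables ipH ipH UNIV UNIV.
     P \<circ> P = P \<and> range (adj ipH ipH UNIV UNIV P) = M \<and> range (T \<circ> P) \<subseteq> N)" (is "_ \<longleftrightarrow> ?rhs")
proof
  assume reducible
  then obtain X where X: "X \<in> adjointables ipH ipH M M'"
    and XN: "\<And>x. x \<in> M \<Longrightarrow> T (X x) - T x \<in> N"
    by (auto simp: reducible_def)
  obtain X' where X': "is_adjoint ipH ipH (X \<circ> PM) (X' \<circ> proj ipH M')" "X' \<in> M' \<rightarrow> M"
    using H.adjointable_extension[OF splits_M splits_M' X] .
  let ?P = "PM - (X \<circ> PM)" and ?Q = "PM - (X' \<circ> proj ipH M')"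
  have P: "is_adjoint ipH ipH ?P ?Q"
    by (rule H.is_adjoint_diff[OF adjoint_PM X'(1)])
  have PMM: "PM x \<in> M" for x by (rule H.proj_mem[OF splits_M])
  \<comment> \<open>The term with \<open>X\<close> has values in \<open>M'\<close> and is
    annihilated by \<open>PM\<close>. As \<open>?P\<close> depends only on \<open>PM\<close> of its
    argument, idempotence follows.\<close>
  have "PM (?P x) = PM x" for x
    using adjointable_mem[OF X PMM]
    by (simp add: H.proj_diff H.proj_same H.proj_orth splits_M PMM)
  then have "?P \<circ> ?P = ?P" by (simp add: fun_eq_iff)
  moreover have "range ?Q = M"
  proof
    show "range ?Q \<subseteq> M"
      using funcset_mem[OF X'(2) H.proj_mem[OF splits_M']] PMM splits_M
      by (auto simp: splits_def)
    \<comment> \<open>On \<open>M\<close> the map \<open>?Q\<close> evaluates \<open>X'\<close> at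
      zero. Additivity is known for the extension of \<open>X'\<close>, being part of an adjoint
      pair, and yields the value there.\<close>
    have "X' 0 = 0"
      using HH.is_adjoint_additive[OF HH.is_adjoint_sym[OF X'(1)], of 0 0]
        H.proj_same[OF splits_M' H.zero_mem_splits[OF splits_M']] by simp
    then have "?Q x = x" if "x \<in> M" for x
      using that by (simp add: H.proj_same H.proj_orth_eq splits_M)
    then show "M \<subseteq> range ?Q" by (metis rangeI subsetI)
  qed
  moreover have "T (?P x) \<in> N" for x
  proof -
    have "T (?P x) = 0 - (T (X (PM x)) - T (PM x))" by (simp add: T_diff)
    then show ?thesis
      using XN[OF PMM] splits_N K.zero_mem_splits[OF splits_N] by (metis splits_def)
  qed
  ultimately show ?rhs
    using P HH.adj_UNIV[OF P] by (intro bexI[of _ ?P]) (auto simp: adjointables_UNIV_iff)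
next
  assume ?rhs
  then obtain P Q where P: "is_adjoint ipH ipH P Q" and idem: "P \<circ> P = P"
    and "range (adj ipH ipH UNIV UNIV P) = M" and TP: "range (T \<circ> P) \<subseteq> N"
    by (auto simp: adjointables_UNIV_iff)
  then have rQ: "range Q = M" using HH.adj_UNIV by metis
  have QQ: "Q \<circ> Q = Q"
    using HH.adjoint_eq_iff[OF is_adjoint_comp[OF P P] P] idem by simp
  have "Q x = x" if "x \<in> M" for x
    using that rQ QQ by (metis comp_apply imageE)
  then have "Q \<circ> PM = PM"
    by (simp add: fun_eq_iff H.proj_mem[OF splits_M])
  then have "PM \<circ> P = PM"
    using HH.adjoint_eq_iff[OF is_adjoint_comp[OF P adjoint_PM] adjoint_PM] by simp
  then have "PM ((PM - P) x) = 0" for x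
    by (simp add: fun_eq_iff H.proj_diff H.proj_same H.proj_mem splits_M)
  \<comment> \<open>On \<open>M\<close> the map \<open>PM - P\<close> is the identity minus
    \<open>P\<close>; being annihilated by \<open>PM\<close> places its values in
    \<open>M'\<close>.\<close>
  then have "restrict (PM - P) M \<in> adjointables ipH ipH M M'"
    by (intro H.restrict_adjointable[OF H.is_adjoint_diff[OF adjoint_PM P] splits_M])
      (simp add: H.proj_eq_zero_iff[OF splits_M])
  moreover have "T (restrict (PM - P) M x) - T x \<in> N" if "x \<in> M" for x
  proof -
    have "T (restrict (PM - P) M x) - T x = 0 - T (P x)"
      using that by (simp add: H.proj_same splits_M T_diff)
    moreover have "T (P x) \<in> N" using TP by auto
    ultimately show ?thesis
      using splits_N K.zero_mem_splits[OF splits_N] by (metis splits_def)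
  qed
  ultimately show reducible unfolding reducible_def by blast
qed

text \<open>The same \<open>C\<close> serves both sides. The operator in the null space depends only
  on the \<open>M\<close>-component of its argument, so a sum decomposition with \<open>M'\<close>
  forces it to vanish on all of \<open>M\<close>. Applying \<open>PM\<close> first also means that
  \<open>C\<close> is evaluated only on its domain.\<close>

lemma reducible_iff_decomposition:
  "reducible \<longleftrightarrow> (\<exists>C \<in> adjointables ipH ipH M M'.
     UNIV = M' + null_space ((id - PN) \<circ> T \<circ> (id - C) \<circ> PM))"
proof -
  have "(\<forall>x\<in>M. T (C x) - T x \<in> N) \<longleftrightarrow>
      UNIV = M' + null_space ((id - PN) \<circ> T \<circ> (id - C) \<circ> PM)"
    (is "?l \<longleftrightarrow> UNIV = M' + null_space ?Z")
    if "C \<in> adjointables ipH ipH M M'" for C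
  proof -
    have Z: "?Z x = 0 \<longleftrightarrow> T (C (PM x)) - T (PM x) \<in> N" for x
      by (auto simp: diff_mem_N_iff T_diff K.proj_diff[OF splits_N] algebra_simps)
    show ?thesis
    proof
      assume ?l
      then have "null_space ?Z = UNIV"
        using Z H.proj_mem[OF splits_M] by blast
      moreover have "x \<in> M' + UNIV" for x
        using set_plus_intro[of 0 M' x UNIV] H.zero_mem_splits[OF splits_M'] by simp
      ultimately show "UNIV = M' + null_space ?Z" by auto
    next
      assume U: "UNIV = M' + null_space ?Z"
      show ?l
      proof
        fix x assume x: "x \<in> M"
        have "x \<in> M' + null_space ?Z" using U by blast
        then obtain m n where mn: "m \<in> M'" "n \<in> null_space ?Z" "x = m + n"
          by (auto elim: set_plus_elim)
        \<comment> \<open>The summand \<open>n\<close> and \<open>x\<close> differ by an element of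
          \<open>M'\<close>, so \<open>PM n = x\<close>, and the vanishing at \<open>n\<close>
          becomes the claim for \<open>x\<close>.\<close>
        have "n - x \<in> M'"
          using mn H.orth_diff[of 0 M m] H.zero_mem_splits[OF splits_M'] by simp
        then have "PM n - x = 0"
          using H.proj_orth[OF splits_M, of "n - x"] x by (simp add: H.proj_diff H.proj_same splits_M)
        then show "T (C x) - T x \<in> N" using Z[of n] mn(2) by simp
      qed
    qed
  qed
  then show ?thesis by (auto simp: reducible_def)
qed

end

section \<open>Combining the two halves\<close>

theorem proposition4p1:
  fixes actH :: "'h::complex_banach \<Rightarrow> 'a::cstar_algebra \<Rightarrow> 'h"
    and ipH :: "'h \<Rightarrow> 'h \<Rightarrow> 'a"
    and actK :: "'k::complex_banach \<Rightarrow> 'a \<Rightarrow> 'k"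
    and ipK :: "'k \<Rightarrow> 'k \<Rightarrow> 'a"
    and M :: "'h set" and N :: "'k set" and T :: "'h \<Rightarrow> 'k"
  assumes "hilbert_module actH ipH"
    and "hilbert_module actK ipK"
    and "orth_complemented actH ipH M"
    and "orth_complemented actK ipK N"
    and "T \<in> adjointables ipH ipK UNIV UNIV"
  defines "M' \<equiv> orth ipH M" and "N' \<equiv> orth ipK N"
    and "PM \<equiv> proj ipH M" and "PN \<equiv> proj ipK N"
  defines "T12 \<equiv> block ipH ipK T M' N" and "T21 \<equiv> block ipH ipK T M N'"
    and "T22 \<equiv> block ipH ipK T M' N'"
  shows "(complementable ipH ipK M N T \<longleftrightarrow>
           (\<exists>X \<in> adjointables ipH ipH M M'. compose M T22 X = T21) \<and>
           (\<exists>Y \<in> adjointables ipK ipK N N'.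
              compose N (adj ipH ipK M' N' T22) Y = adj ipH ipK M' N T12)) \<and>
         (complementable ipH ipK M N T \<longleftrightarrow>
           (\<exists>P \<in> adjointables ipH ipH UNIV UNIV. \<exists>Q \<in> adjointables ipK ipK UNIV UNIV.
              P \<circ> P = P \<and> Q \<circ> Q = Q \<and>
              range (adj ipH ipH UNIV UNIV P) = M \<and> range (T \<circ> P) \<subseteq> N \<and>
              range Q = N \<and> range (adj ipH ipK UNIV UNIV (Q \<circ> T)) \<subseteq> M)) \<and>
         (complementable ipH ipK M N T \<longleftrightarrow>
           (\<exists>C \<in> adjointables ipH ipH M M'. \<exists>D \<in> adjointables ipK ipK N N'.
              UNIV = M' + null_space ((id - PN) \<circ> T \<circ> (id - C) \<circ> PM) \<and>
              UNIV = N' + null_space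
                ((id - PM) \<circ> adj ipH ipK UNIV UNIV T \<circ> (id - D) \<circ> PN)))"
proof -
  interpret H: hilbert_module actH ipH by fact
  interpret K: hilbert_module actK ipK by fact
  interpret HK: two_modules actH ipH actK ipK ..
  interpret KH: two_modules actK ipK actH ipH ..
  interpret KK: two_modules actK ipK actK ipK ..
  note M = orth_complemented_splits[OF assms(3)] and N = orth_complemented_splits[OF assms(4)]
  obtain S where TS: "is_adjoint ipH ipK T S"
    using assms(5) by (auto simp: adjointables_UNIV_iff)
  interpret A: split_operator actH ipH actK ipK M N T S
    by unfold_locales (fact M N TS)+
  \<comment> \<open>The second half is the first one for the adjoint \<open>S\<close>, with the
    modules and submodules exchanged.\<close>
  interpret B: split_operator actK ipK actH ipH N M S T
    by unfold_locales (fact M N HK.is_adjoint_sym[OF TS])+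
  note M' = H.splits_orth[OF M] and N' = K.splits_orth[OF N]
  have cM: "is_adjoint ipH ipH (id - PM) (id - PM)"
    unfolding PM_def by (rule H.is_adjoint_diff[OF is_adjoint_id H.is_adjoint_proj[OF M]])
  have cN: "is_adjoint ipK ipK (id - PN) (id - PN)"
    unfolding PN_def by (rule K.is_adjoint_diff[OF is_adjoint_id K.is_adjoint_proj[OF N]])
  \<comment> \<open>With \<open>R\<close> the adjoint of \<open>L\<close>, each equation for
    \<open>L\<close> is the adjoint of one for \<open>R\<close>, as both complementary projections
    are self-adjoint.\<close>
  have left_factor: "(\<exists>L \<in> adjointables ipK ipK UNIV UNIV.
      L \<circ> (id - PN) = L \<and> L \<circ> T \<circ> (id - PM) = T \<circ> (id - PM)) \<longleftrightarrow>
    (\<exists>R \<in> adjointables ipK ipK UNIV UNIV.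
      (id - PN) \<circ> R = R \<and> (id - PM) \<circ> S \<circ> R = (id - PM) \<circ> S)"
  proof -
    have "(L \<circ> (id - PN) = L \<and> L \<circ> T \<circ> (id - PM) = T \<circ> (id - PM)) \<longleftrightarrow>
        ((id - PN) \<circ> R = R \<and> (id - PM) \<circ> S \<circ> R = (id - PM) \<circ> S)"
      if LR: "is_adjoint ipK ipK L R" for L R
      using KK.adjoint_eq_iff[OF is_adjoint_comp[OF cN LR] LR]
        HK.adjoint_eq_iff[OF is_adjoint_comp[OF cM is_adjoint_comp[OF TS LR]]
          is_adjoint_comp[OF cM TS]]
      by (simp add: comp_assoc)
    then show ?thesis by (rule KK.bex_adjointables_swap)
  qed
  have compl: "complementable ipH ipK M N T \<longleftrightarrow> A.reducible \<and> B.reducible"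
    unfolding A.reducible_iff_right_factor B.reducible_iff_right_factor
    using left_factor unfolding complementable_def PM_def PN_def by blast
  \<comment> \<open>The idempotent \<open>P\<close> supplied by \<open>B\<close> is the adjoint of
    \<open>Q\<close>, so \<open>S \<circ> P\<close> is the adjoint of \<open>Q \<circ> T\<close> and
    the range conditions correspond.\<close>
  have idem: "B.reducible \<longleftrightarrow> (\<exists>Q \<in> adjointables ipK ipK UNIV UNIV.
      Q \<circ> Q = Q \<and> range Q = N \<and> range (adj ipH ipK UNIV UNIV (Q \<circ> T)) \<subseteq> M)"
  proof -
    have "(P \<circ> P = P \<and> range (adj ipK ipK UNIV UNIV P) = N \<and> range (S \<circ> P) \<subseteq> M) \<longleftrightarrow>
        (Q \<circ> Q = Q \<and> range Q = N \<and> range (adj ipH ipK UNIV UNIV (Q \<circ> T)) \<subseteq> M)"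
      if PQ: "is_adjoint ipK ipK P Q" for P Q
      using KK.adjoint_eq_iff[OF is_adjoint_comp[OF PQ PQ] PQ] KK.adj_UNIV[OF PQ]
        HK.adj_UNIV[OF is_adjoint_comp[OF TS KK.is_adjoint_sym[OF PQ]]]
      by simp
    then show ?thesis
      unfolding B.reducible_iff_idempotent by (rule KK.bex_adjointables_swap)
  qed
  have "complementable ipH ipK M N T \<longleftrightarrow>
      (\<exists>X \<in> adjointables ipH ipH M M'. compose M T22 X = T21) \<and>
      (\<exists>Y \<in> adjointables ipK ipK N N'.
        compose N (adj ipH ipK M' N' T22) Y = adj ipH ipK M' N T12)"
    unfolding compl A.reducible_iff_equation B.reducible_iff_equation assms(6-)
      HK.adj_block[OF TS M' N'] HK.adj_block[OF TS M' N] ..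
  moreover have "complementable ipH ipK M N T \<longleftrightarrow>
      (\<exists>P \<in> adjointables ipH ipH UNIV UNIV. \<exists>Q \<in> adjointables ipK ipK UNIV UNIV.
        P \<circ> P = P \<and> Q \<circ> Q = Q \<and>
        range (adj ipH ipH UNIV UNIV P) = M \<and> range (T \<circ> P) \<subseteq> N \<and>
        range Q = N \<and> range (adj ipH ipK UNIV UNIV (Q \<circ> T)) \<subseteq> M)"
    unfolding compl A.reducible_iff_idempotent idem by blast
  moreover have "complementable ipH ipK M N T \<longleftrightarrow>
      (\<exists>C \<in> adjointables ipH ipH M M'. \<exists>D \<in> adjointables ipK ipK N N'.
        UNIV = M' + null_space ((id - PN) \<circ> T \<circ> (id - C) \<circ> PM) \<and>
        UNIV = N' + null_space
          ((id - PM) \<circ> adj ipH ipK UNIV UNIV T \<circ> (id - D) \<circ> PN))"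
    unfolding compl A.reducible_iff_decomposition B.reducible_iff_decomposition
      HK.adj_UNIV[OF TS] assms(6-9) by blast
  ultimately show ?thesis by blast
qed

end
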